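(* There is an absolute constant $C>0$ such that for all $n,k\in\mathbb{N}$, $\mathrm{signrank}(\mathrm{HD}_k^n) = 2^{O(k)}$, i.e. the sign-rank of the $k$-Hamming Distance matrix on $n$ bits is bounded by $2^{O(k)}$ with the implicit constant independent of $n$ and $k$.
   Context: For a boolean matrix $M\in\{0,1\}^{N\times N}$ let $M_\pm\in\{\pm1\}^{N\times N}$ be given by $M_\pm(i,j)=2M(i,j)-1$. The sign-rank $\mathrm{signrank}(M)$ is the smallest rank of a real matrix $A\in\mathbb{R}^{N\times N}$ with $\mathrm{sign}(A(i,j))=M_\pm(i,j)$ for all $i,j$ (in particular all entries of $A$ are nonzero). The $k$-Hamming Distance matrix $\mathrm{HD}_k^n\in\{0,1\}^{2^n\times 2^n}$ has rows and columns indexed by $\{0,1\}^n$ and $\mathrm{HD}_k^n(x,y)=1$ iff the Hamming distance $\mathrm{dist}(x,y)$ (number of coordinates where $x,y$ differ) equals exactly $k$. *)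

theory Defs
  imports "HOL-Analysis.Analysis" "Jordan_Normal_Form.DL_Rank"
begin

definition pm_mat :: "bool mat \<Rightarrow> real mat" where
  "pm_mat M = map_mat (\<lambda>b. 2 * of_bool b - 1) M"

definition sign_represents :: "real mat \<Rightarrow> bool mat \<Rightarrow> bool" where
  "sign_represents A M \<longleftrightarrow> A \<in> carrier_mat (dim_row M) (dim_col M) \<and> map_mat sgn A = pm_mat M"

text \<open>The first argument of \<^const>\<open>vec_space.rank\<close> is the dimension of the column space's
  ambient space, i.e. the number of rows.\<close>

definition signrank :: "bool mat \<Rightarrow> nat" where
  "signrank M = (LEAST r. \<exists>A. sign_represents A M \<and> vec_space.rank (dim_row M) A = r)"

definition hamming_dist :: "'a list \<Rightarrow> 'a list \<Rightarrow> nat" where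
  "hamming_dist x y = card {l. l < length x \<and> x ! l \<noteq> y ! l}"

text \<open>Matrices are indexed by natural numbers, so the cube \<open>{0,1}\<^sup>n\<close> is enumerated by binary
  expansion; \<open>bij_betw_cube_point\<close> below shows that this is a bijection from \<open>{..<2 ^ n}\<close>
  to the bit strings of length \<open>n\<close>.\<close>

definition cube_point :: "nat \<Rightarrow> nat \<Rightarrow> bool list" where
  "cube_point n i = map (bit i) [0..<n]"

definition HD :: "nat \<Rightarrow> nat \<Rightarrow> bool mat" where
  "HD k n = mat (2 ^ n) (2 ^ n) (\<lambda>(i, j). hamming_dist (cube_point n i) (cube_point n j) = k)"

lemma bij_betw_cube_point:
  "bij_betw (cube_point n) {..<2 ^ n} {x. length x = n}"
proof -
  have inj: "inj_on (cube_point n) {..<2 ^ n}"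
  proof (rule inj_onI)
    fix i j :: nat
    assume i: "i \<in> {..<2 ^ n}" and j: "j \<in> {..<2 ^ n}" and eq: "cube_point n i = cube_point n j"
    have "take_bit n i = take_bit n j"
      using eq by (intro bit_eqI) (auto simp: cube_point_def bit_take_bit_iff)
    then show "i = j"
      using i j by (simp add: take_bit_nat_eq_self)
  qed
  have fin: "finite {x :: bool list. length x = n}"
    using finite_lists_length_eq[of "UNIV :: bool set" n] by simp
  have "card {x :: bool list. length x = n} = 2 ^ n"
    using card_lists_length_eq[of "UNIV :: bool set" n] by (simp add: card_UNIV_bool)
  moreover have "card (cube_point n ` {..<2 ^ n}) = 2 ^ n"
    using card_image[OF inj] by simp
  moreover have "cube_point n ` {..<2 ^ n} \<subseteq> {x. length x = n}"
    by (auto simp: cube_point_def)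
  ultimately have "cube_point n ` {..<2 ^ n} = {x. length x = n}"
    using fin by (intro card_subset_eq) auto
  with inj show ?thesis
    by (simp add: bij_betw_def)
qed

lemma sign_represents_pm_mat: "sign_represents (pm_mat M) M"
  by (auto simp: sign_represents_def pm_mat_def)

text \<open>Hence the minimum in \<^const>\<open>signrank\<close> is over a nonempty set.\<close>

lemma signrank_attained:
  "\<exists>A. sign_represents A M \<and> vec_space.rank (dim_row M) A = signrank M"
  unfolding signrank_def by (rule LeastI_ex) (use sign_represents_pm_mat in blast)

lemma signrank_le:
  "sign_represents A M \<Longrightarrow> signrank M \<le> vec_space.rank (dim_row M) A"
  unfolding signrank_def by (rule Least_le) blast

end

theory Submission
  imports Defs
begin

text \<open>
  The vector \<open>x - y\<close> has entries in \<open>{-1, 0, 1}\<close> and its support has size \<open>dist x y\<close>.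
  Weight its coordinates by generic reals \<open>c l\<close> and form the moments
  \<open>s m = (\<Sum>l. c l * (x l - y l) * l ^ m)\<close>.  As for sparse recovery (Prony's method), the
  \<open>k \<times> k\<close> Hankel determinant \<open>D k\<close> of these moments vanishes iff \<open>dist x y < k\<close>, so
  \<open>(D k)\<^sup>2 - M * (D (k + 1))\<^sup>2 - e\<close> has the required signs when \<open>e\<close> is small and \<open>M\<close> is large.
  For fixed \<open>y\<close> this is a polynomial of degree at most \<open>2 k + 2\<close> in the \<open>2 k + 1\<close> moments of
  \<open>x\<close>, and there are only \<open>2 ^ O(k)\<close> monomials of that kind, whatever \<open>n\<close> is.
\<close>

section \<open>Rank of sums of product matrices\<close>

text \<open>Every \<open>t\<close> contributes an outer product, of rank at most 1, and rank is
  subadditive.\<close>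

lemma (in vec_space) rank_le_card_products:
  fixes F G :: "'b \<Rightarrow> nat \<Rightarrow> 'a"
  assumes "finite T" "A \<in> carrier_mat n nc"
    and "\<And>r c. r < n \<Longrightarrow> c < nc \<Longrightarrow> A $$ (r, c) = (\<Sum>t\<in>T. F t r * G t c)"
  shows "rank A \<le> card T"
  using assms
proof (induction T arbitrary: A rule: finite_induct)
  case empty
  then have "A = 0\<^sub>m n nc" by (intro eq_matI) auto
  then show ?case by (simp add: rank_0I)
next
  case (insert t T)
  define B where "B = mat n nc (\<lambda>(r, c). F t r * G t c)"
  define A' where "A' = mat n nc (\<lambda>(r, c). \<Sum>t\<in>T. F t r * G t c)"
  have carr: "B \<in> carrier_mat n nc" "A' \<in> carrier_mat n nc"
    by (auto simp: B_def A'_def)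
  have "A = B + A'"
    using insert by (intro eq_matI) (auto simp: B_def A'_def)
  then have "rank A \<le> rank B + rank A'"
    using rank_subadditive[OF carr] by simp
  moreover have "rank B \<le> 1"
    by (rule rank_le_1_product_entries[OF carr(1), of "F t" "G t"]) (auto simp: B_def)
  moreover have "rank A' \<le> card T"
    by (rule insert.IH) (auto simp: A'_def)
  ultimately show ?case using insert.hyps by simp
qed

section \<open>Homogeneous forms in given functions\<close>

text \<open>Monomials of degree \<open>d\<close> are encoded as multisets of generators, which makes
  them easy to count. The functions \<open>p m\<close> may satisfy relations, so only the existence
  of coefficients is asked for.\<close>

definition hforms :: "(nat \<Rightarrow> 'i \<Rightarrow> real) \<Rightarrow> nat \<Rightarrow> nat \<Rightarrow> ('i \<Rightarrow> real) set" where
  "hforms p q d =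
    {f. \<exists>a. \<forall>x. f x = (\<Sum>X\<in>multisets_of_size {..q} d. a X * (\<Prod>m\<in>#X. p m x))}"

lemma hforms_add:
  assumes "f \<in> hforms p q d" "g \<in> hforms p q d"
  shows "(\<lambda>x. f x + g x) \<in> hforms p q d"
proof -
  from assms obtain a b where
    "\<And>x. f x = (\<Sum>X\<in>multisets_of_size {..q} d. a X * (\<Prod>m\<in>#X. p m x))"
    "\<And>x. g x = (\<Sum>X\<in>multisets_of_size {..q} d. b X * (\<Prod>m\<in>#X. p m x))"
    unfolding hforms_def by blast
  then show ?thesis
    unfolding hforms_def
    by (intro CollectI exI[of _ "\<lambda>X. a X + b X"]) (simp add: sum.distrib distrib_right)
qed

lemma hforms_cmult:
  assumes "f \<in> hforms p q d"
  shows "(\<lambda>x. c * f x) \<in> hforms p q d"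
proof -
  from assms obtain a where
    "\<And>x. f x = (\<Sum>X\<in>multisets_of_size {..q} d. a X * (\<Prod>m\<in>#X. p m x))"
    unfolding hforms_def by blast
  then show ?thesis
    unfolding hforms_def
    by (intro CollectI exI[of _ "\<lambda>X. c * a X"]) (simp add: sum_distrib_left mult.assoc)
qed

lemma hforms_zero: "(\<lambda>x. 0) \<in> hforms p q d"
  unfolding hforms_def by (auto intro: exI[of _ "\<lambda>_. 0"])

lemma hforms_sum:
  assumes "\<And>i. i \<in> I \<Longrightarrow> f i \<in> hforms p q d"
  shows "(\<lambda>x. \<Sum>i\<in>I. f i x) \<in> hforms p q d"
  using assms
  by (induction I rule: infinite_finite_induct) (simp_all add: hforms_zero hforms_add)

lemma hforms_monom:
  assumes "X \<in> multisets_of_size {..q} d"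
  shows "(\<lambda>x. \<Prod>m\<in>#X. p m x) \<in> hforms p q d"
  unfolding hforms_def
  using assms by (intro CollectI exI[of _ "\<lambda>Y. of_bool (Y = X)"]) 
    (simp add: of_bool_def if_distrib if_distribR sum.delta finite_multisets_of_size cong: if_cong)

lemma hforms_mult:
  assumes f: "f \<in> hforms p q d" and g: "g \<in> hforms p q e"
  shows "(\<lambda>x. f x * g x) \<in> hforms p q (d + e)"
proof -
  let ?M = "multisets_of_size {..q}"
  from f g obtain a b where
    a: "\<And>x. f x = (\<Sum>X\<in>?M d. a X * (\<Prod>m\<in>#X. p m x))" and
    b: "\<And>x. g x = (\<Sum>X\<in>?M e. b X * (\<Prod>m\<in>#X. p m x))"
    unfolding hforms_def by blast
  have "(\<lambda>x. \<Sum>X\<in>?M d. \<Sum>Y\<in>?M e. (a X * b Y) * (\<Prod>m\<in>#X + Y. p m x)) \<in> hforms p q (d + e)"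
    by (intro hforms_sum hforms_cmult hforms_monom) (auto simp: multisets_of_size_def)
  moreover have "f x * g x = (\<Sum>X\<in>?M d. \<Sum>Y\<in>?M e. (a X * b Y) * (\<Prod>m\<in>#X + Y. p m x))" for x
    unfolding a b sum_product by (intro sum.cong refl) simp
  ultimately show ?thesis by simp
qed

lemma hforms_gen:
  assumes "m \<le> q"
  shows "p m \<in> hforms p q 1"
  using hforms_monom[of "{#m#}" q 1 p] assms by (simp add: multisets_of_size_def)

lemma hforms_one: "(\<lambda>x. 1) \<in> hforms p q 0"
  using hforms_monom[of "{#}" q 0 p] by simp

lemma hforms_prod:
  assumes "finite I" "\<And>i. i \<in> I \<Longrightarrow> f i \<in> hforms p q 1"
  shows "(\<lambda>x. \<Prod>i\<in>I. f i x) \<in> hforms p q (card I)"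
  using assms
proof (induction I rule: finite_induct)
  case empty
  then show ?case by (simp add: hforms_one)
next
  case (insert i I)
  then have "(\<lambda>x. f i x * (\<Prod>i\<in>I. f i x)) \<in> hforms p q (1 + card I)"
    by (intro hforms_mult) auto
  with insert.hyps show ?case by simp
qed

text \<open>Powers of a generator that is constantly 1 pad the monomials, so inhomogeneous
  polynomials are covered as well.\<close>

lemma hforms_mono:
  assumes "f \<in> hforms p q d" "d \<le> e" and one: "\<And>x. p 0 x = 1"
  shows "f \<in> hforms p q e"
proof -
  have "(\<lambda>x. \<Prod>i<e - d. p 0 x) \<in> hforms p q (card {..<e - d})"
    by (intro hforms_prod hforms_gen) auto
  then have "(\<lambda>x. 1) \<in> hforms p q (e - d)" by (simp add: one)
  from hforms_mult[OF assms(1) this] \<open>d \<le> e\<close> show ?thesis by simp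
qed

text \<open>In the Leibniz expansion every term is a signed product of \<open>k\<close> entries,
  each of degree 1.\<close>

lemma hforms_det:
  fixes H :: "'i \<Rightarrow> real mat"
  assumes "\<And>x. H x \<in> carrier_mat k k"
    and "\<And>a b. a < k \<Longrightarrow> b < k \<Longrightarrow> (\<lambda>x. H x $$ (a, b)) \<in> hforms p q 1"
  shows "(\<lambda>x. Determinant.det (H x)) \<in> hforms p q k"
proof -
  have "(\<lambda>x. \<Sum>\<pi> \<in> {\<pi>. \<pi> permutes {0..<k}}. signof \<pi> * (\<Prod>a\<in>{0..<k}. H x $$ (a, \<pi> a)))
      \<in> hforms p q (card {0..<k})"
    using assms(2) by (intro hforms_sum hforms_cmult hforms_prod) (auto simp: permutes_in_image)
  then show ?thesis
    by (simp add: Determinant.det_def'[OF assms(1)])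
qed

lemma card_multisets_of_size_le: "card (multisets_of_size {..q} d) \<le> 2 ^ (q + d)"
  by (simp add: card_multisets_of_size binomial_le_pow2)

text \<open>The row enters only through the monomials and the column only through the coefficients,
  so each monomial gives one product matrix. Hence the bound is free of \<open>N\<close>.\<close>

lemma rank_le_hforms:
  fixes A :: "real mat"
  assumes A: "A \<in> carrier_mat N nc"
    and p: "\<And>c. c < nc \<Longrightarrow> \<exists>f \<in> hforms p q d. \<forall>r<N. A $$ (r, c) = f r"
  shows "vec_space.rank N A \<le> 2 ^ (q + d)"
proof -
  let ?M = "multisets_of_size {..q} d"
  have "\<exists>a. \<forall>r<N. A $$ (r, c) = (\<Sum>X\<in>?M. a X * (\<Prod>m\<in>#X. p m r))" if "c < nc" for c
    using p[OF that] unfolding hforms_def by force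
  then obtain a where a: "\<And>r c. c < nc \<Longrightarrow> r < N \<Longrightarrow>
      A $$ (r, c) = (\<Sum>X\<in>?M. a c X * (\<Prod>m\<in>#X. p m r))"
    by metis
  have "vec_space.rank N A \<le> card ?M"
    by (rule vec_space.rank_le_card_products
        [OF _ A, where F = "\<lambda>X r. \<Prod>m\<in>#X. p m r" and G = "\<lambda>X c. a c X"])
      (auto simp: a mult.commute)
  with card_multisets_of_size_le show ?thesis by (rule order_trans[rotated])
qed

section \<open>Hankel determinants of moments\<close>

definition moment :: "nat \<Rightarrow> (nat \<Rightarrow> real) \<Rightarrow> nat \<Rightarrow> real" where
  "moment n g m = (\<Sum>l<n. g l * real l ^ m)"

text \<open>The entry type stays open because entries are also taken from a polynomial ring.\<close>

definition hankel :: "nat \<Rightarrow> (nat \<Rightarrow> 'a) \<Rightarrow> 'a mat" where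
  "hankel k s = mat k k (\<lambda>(a, b). s (a + b))"

lemma hankel_carrier [simp]: "hankel k s \<in> carrier_mat k k"
  by (simp add: hankel_def)

text \<open>The Hankel matrix factors as a transposed Vandermonde matrix, \<open>diag g\<close> and
  a Vandermonde matrix on the nodes \<open>l < n\<close>. The inner sum evaluates the polynomial
  with coefficients \<open>v\<close> at a node.\<close>

lemma hankel_moment_mult_vec:
  assumes "v \<in> carrier_vec k" "a < k"
  shows "vec_index (hankel k (moment n g) *\<^sub>v v) a
    = (\<Sum>l<n. g l * real l ^ a * (\<Sum>b<k. vec_index v b * real l ^ b))"
proof -
  have "vec_index (hankel k (moment n g) *\<^sub>v v) a = (\<Sum>b<k. moment n g (a + b) * vec_index v b)"
    using assms by (simp add: hankel_def scalar_prod_def atLeast0LessThan)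
  also have "\<dots> = (\<Sum>b<k. \<Sum>l<n. g l * real l ^ a * (vec_index v b * real l ^ b))"
    by (simp add: moment_def sum_distrib_right sum_distrib_left power_add mult_ac)
  also have "\<dots> = (\<Sum>l<n. \<Sum>b<k. g l * real l ^ a * (vec_index v b * real l ^ b))"
    by (rule sum.swap)
  finally show ?thesis by (simp add: sum_distrib_left)
qed

lemma poly_eq_sum_lessThan:
  fixes q :: "real poly"
  assumes "degree q < k"
  shows "poly q x = (\<Sum>b<k. coeff q b * x ^ b)"
proof -
  have "(\<Sum>b\<le>degree q. coeff q b * x ^ b) = (\<Sum>b<k. coeff q b * x ^ b)"
    using assms by (intro sum.mono_neutral_left) (auto simp: coeff_eq_0)
  then show ?thesis by (simp add: poly_altdef)
qed

text \<open>This is the locator polynomial of Prony's method.\<close>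

definition root_poly :: "nat set \<Rightarrow> real poly" where
  "root_poly S = (\<Prod>l\<in>S. [:- real l, 1:])"

lemma poly_root_poly_eq_0_iff: "finite S \<Longrightarrow> poly (root_poly S) (real l) = 0 \<longleftrightarrow> l \<in> S"
  by (auto simp: root_poly_def poly_prod)

lemma root_poly_nonzero: "finite S \<Longrightarrow> root_poly S \<noteq> 0"
  by (simp add: root_poly_def)

lemma degree_root_poly: "degree (root_poly S) = card S"
proof (cases "finite S")
  case True
  then show ?thesis by (simp add: root_poly_def degree_prod_eq_sum_degree)
qed (simp add: root_poly_def)

text \<open>The coefficients of the polynomial with roots at the support span a kernel vector.\<close>

lemma det_hankel_moment_eq_0:
  assumes "card {l. l < n \<and> g l \<noteq> 0} < k"
  shows "Determinant.det (hankel k (moment n g)) = 0"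
proof -
  define S where "S = {l. l < n \<and> g l \<noteq> 0}"
  have S: "finite S" "card S < k" using assms by (simp_all add: S_def)
  define v where "v = Matrix.vec k (coeff (root_poly S))"
  have v: "v \<in> carrier_vec k" by (simp add: v_def)
  have "v \<noteq> 0\<^sub>v k"
  proof
    assume "v = 0\<^sub>v k"
    \<comment> \<open>The index is in range because \<open>card S < k\<close>, and the entry there
      is the leading coefficient.\<close>
    then have "vec_index v (card S) = 0" using S by simp
    then have "lead_coeff (root_poly S) = 0" using S by (simp add: v_def degree_root_poly)
    then show False using root_poly_nonzero[OF S(1)] by simp
  qed
  moreover have "hankel k (moment n g) *\<^sub>v v = 0\<^sub>v k"
  proof (rule eq_vecI)
    fix a assume "a < dim_vec (0\<^sub>v k :: real vec)"
    then have a: "a < k" by simp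
    have "vec_index (hankel k (moment n g) *\<^sub>v v) a
        = (\<Sum>l<n. g l * real l ^ a * poly (root_poly S) (real l))"
      unfolding hankel_moment_mult_vec[OF v a]
      by (simp add: poly_eq_sum_lessThan[of _ k] degree_root_poly S v_def)
    also have "\<dots> = 0"
    proof (intro sum.neutral ballI)
      fix l assume "l \<in> {..<n}"
      then show "g l * real l ^ a * poly (root_poly S) (real l) = 0"
        using poly_root_poly_eq_0_iff[OF S(1), of l] by (cases "l \<in> S") (auto simp: S_def)
    qed
    finally show "vec_index (hankel k (moment n g) *\<^sub>v v) a = vec_index (0\<^sub>v k) a"
      using a by simp
  qed (simp add: hankel_def)
  ultimately show ?thesis
    using v by (subst det_0_iff_vec_prod_zero_field[OF hankel_carrier]) blast
qed

text \<open>A kernel vector is a polynomial \<open>q\<close> of degree below \<open>k\<close> with \<open>\<Sum>l. g l * r l * q l = 0\<close>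
  for all polynomials \<open>r\<close> of degree below \<open>k\<close>.  Choosing for \<open>r\<close> the Lagrange polynomials of the
  support shows that \<open>q\<close> vanishes on the support, which has \<open>k\<close> points.\<close>

lemma det_hankel_moment_neq_0:
  assumes "card {l. l < n \<and> g l \<noteq> 0} = k"
  shows "Determinant.det (hankel k (moment n g)) \<noteq> 0"
proof
  define S where "S = {l. l < n \<and> g l \<noteq> 0}"
  have S: "finite S" "card S = k" using assms by (simp_all add: S_def)
  assume "Determinant.det (hankel k (moment n g)) = 0"
  then obtain v where v: "v \<in> carrier_vec k" "v \<noteq> 0\<^sub>v k" "hankel k (moment n g) *\<^sub>v v = 0\<^sub>v k"
    by (subst (asm) det_0_iff_vec_prod_zero_field[OF hankel_carrier]) blast
  define q where "q = (\<Sum>b<k. monom (vec_index v b) b)"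
  have coeff_q: "coeff q b = (if b < k then vec_index v b else 0)" for b
    by (simp add: q_def coeff_sum)
  have poly_q: "poly q x = (\<Sum>b<k. vec_index v b * x ^ b)" for x
    by (simp add: q_def poly_sum poly_monom)
  have "q \<noteq> 0"
  proof
    assume "q = 0"
    then have "v = 0\<^sub>v k"
      using v(1) coeff_q by (intro eq_vecI) (auto, metis coeff_0)
    with v(2) show False ..
  qed
  have "k > 0"
    using v(1,2) by (cases k) (auto intro: eq_vecI)
  then have deg_q: "degree q < k"
    using coeff_q[of "degree q"] \<open>q \<noteq> 0\<close> by (auto split: if_splits)
  have orth: "(\<Sum>l<n. g l * real l ^ a * poly q (real l)) = 0" if "a < k" for a
    using hankel_moment_mult_vec[OF v(1) that, of n g] v(3) that by (simp add: poly_q)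
  have orth': "(\<Sum>l<n. g l * poly r (real l) * poly q (real l)) = 0" if "degree r < k" for r
  proof -
    have "(\<Sum>l<n. g l * poly r (real l) * poly q (real l))
        = (\<Sum>l<n. \<Sum>a<k. coeff r a * (g l * real l ^ a * poly q (real l)))"
      by (simp add: poly_eq_sum_lessThan[OF that] sum_distrib_left sum_distrib_right mult_ac)
    also have "\<dots> = (\<Sum>a<k. coeff r a * (\<Sum>l<n. g l * real l ^ a * poly q (real l)))"
      by (subst sum.swap) (simp add: sum_distrib_left)
    finally show ?thesis by (simp add: orth)
  qed
  have root: "poly q (real i) = 0" if i: "i \<in> S" for i
  proof -
    define r where "r = root_poly (S - {i})"
    have "degree r < k"
      using S i \<open>k > 0\<close> by (simp add: r_def degree_root_poly)
    from orth'[OF this] have "(\<Sum>l<n. g l * poly r (real l) * poly q (real l)) = 0" .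
    moreover have "(\<Sum>l<n. g l * poly r (real l) * poly q (real l))
        = (\<Sum>l\<in>{i}. g l * poly r (real l) * poly q (real l))"
      using i S(1) by (intro sum.mono_neutral_right)
        (auto simp: r_def poly_root_poly_eq_0_iff S_def)
    ultimately show ?thesis
      using i S(1) by (auto simp: r_def poly_root_poly_eq_0_iff S_def)
  qed
  have "q = 0"
    using root deg_q S by (intro poly_eqI_degree[of "real ` S"]) (auto simp: card_image)
  with \<open>q \<noteq> 0\<close> show False ..
qed

section \<open>Generic weights\<close>

text \<open>The determinant is a polynomial in \<open>t\<close> that does not vanish at \<open>t = 0\<close>.\<close>

lemma finite_zeros_det_hankel_affine:
  fixes s u :: "nat \<Rightarrow> real"
  assumes "Determinant.det (hankel k s) \<noteq> 0"
  shows "finite {t. Determinant.det (hankel k (\<lambda>m. s m + t * u m)) = 0}"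
proof -
  \<comment> \<open>\<open>t\<close> becomes the polynomial variable; evaluation is a ring
    homomorphism and so commutes with the determinant.\<close>
  define P where "P = Determinant.det (hankel k (\<lambda>m. [:s m, u m:]))"
  have P: "poly P t = Determinant.det (hankel k (\<lambda>m. s m + t * u m))" for t
  proof -
    interpret comm_ring_hom "\<lambda>p. poly p t" by unfold_locales auto
    have "poly P t = Determinant.det (map_mat (\<lambda>p. poly p t) (hankel k (\<lambda>m. [:s m, u m:])))"
      unfolding P_def by (rule hom_det[symmetric])
    also have "map_mat (\<lambda>p. poly p t) (hankel k (\<lambda>m. [:s m, u m:]))
        = hankel k (\<lambda>m. s m + t * u m)"
      by (intro eq_matI) (auto simp: hankel_def)
    finally show ?thesis .
  qed
  have "P \<noteq> 0" using assms P[of 0] by auto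
  then show ?thesis unfolding P[symmetric] by (rule poly_roots_finite)
qed

text \<open>The weights are chosen one at a time.  When \<open>c n\<close> is added, a determinant whose size does not
  exceed the support below \<open>n\<close> vanishes for finitely many values of \<open>c n\<close> only; the one remaining
  size is that of the whole support, where every nonzero \<open>c n\<close> will do.\<close>

lemma exists_generic_weights:
  "\<exists>c :: nat \<Rightarrow> real. (\<forall>l. c l \<noteq> 0) \<and>
    (\<forall>\<delta>. (\<forall>l. \<delta> l \<in> {-1, 0, 1}) \<longrightarrow> (\<forall>k \<le> card {l. l < n \<and> \<delta> l \<noteq> 0}.
      Determinant.det (hankel k (moment n (\<lambda>l. c l * \<delta> l))) \<noteq> 0))"
proof (induction n)
  case 0
  show ?case by (intro exI[of _ "\<lambda>_. 1"]) (auto simp: hankel_def)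
next
  case (Suc n)
  then obtain c :: "nat \<Rightarrow> real" where c: "\<And>l. c l \<noteq> 0"
    and gen: "\<And>\<delta> k. (\<forall>l. \<delta> l \<in> {-1, 0, 1}) \<Longrightarrow> k \<le> card {l. l < n \<and> \<delta> l \<noteq> 0} \<Longrightarrow>
      Determinant.det (hankel k (moment n (\<lambda>l. c l * \<delta> l))) \<noteq> 0"
    by blast
  define D where "D t \<delta> k =
    Determinant.det (hankel k (moment (Suc n) (\<lambda>l. (c(n := t)) l * \<delta> l)))" for t \<delta> k
  define E :: "(nat \<Rightarrow> real) set" where "E = {..n} \<rightarrow>\<^sub>E {-1, 0, 1}"
  \<comment> \<open>Only the values of \<delta> up to \<open>n\<close> matter, and restricting to
    them leaves finitely many sign patterns.\<close>
  define r where "r \<delta> = restrict \<delta> {..n}" for \<delta> :: "nat \<Rightarrow> real"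
  have D_r: "D t (r \<delta>) k = D t \<delta> k" for t \<delta> k
  proof -
    have "moment (Suc n) (\<lambda>l. (c(n := t)) l * r \<delta> l) = moment (Suc n) (\<lambda>l. (c(n := t)) l * \<delta> l)"
      unfolding moment_def by (intro ext sum.cong) (auto simp: r_def)
    then show ?thesis by (simp add: D_def)
  qed
  have D_eq: "D t \<delta> k = Determinant.det (hankel k
      (\<lambda>m. moment n (\<lambda>l. c l * \<delta> l) m + t * (\<delta> n * real n ^ m)))" for t \<delta> k
  proof -
    have "moment (Suc n) (\<lambda>l. (c(n := t)) l * \<delta> l)
        = (\<lambda>m. moment n (\<lambda>l. c l * \<delta> l) m + t * (\<delta> n * real n ^ m))"
      unfolding moment_def by (intro ext) (simp add: mult.assoc)
    then show ?thesis by (simp add: D_def)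
  qed
  have card_Suc: "card {l. l < Suc n \<and> \<delta> l \<noteq> 0}
      = card {l. l < n \<and> \<delta> l \<noteq> 0} + of_bool (\<delta> n \<noteq> 0)" for \<delta> :: "nat \<Rightarrow> real"
  proof (cases "\<delta> n = 0")
    case True
    then have "{l. l < Suc n \<and> \<delta> l \<noteq> 0} = {l. l < n \<and> \<delta> l \<noteq> 0}"
      by (auto simp: less_Suc_eq)
    with True show ?thesis by simp
  next
    case False
    then have "{l. l < Suc n \<and> \<delta> l \<noteq> 0} = insert n {l. l < n \<and> \<delta> l \<noteq> 0}"
      by (auto simp: less_Suc_eq)
    with False show ?thesis by simp
  qed
  have fin: "finite {t. t \<noteq> 0 \<and> D t \<delta> k = 0}"
    if \<delta>: "\<forall>l. \<delta> l \<in> {-1, 0, 1}" and k: "k \<le> card {l. l < Suc n \<and> \<delta> l \<noteq> 0}" for \<delta> k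
  proof (cases "k \<le> card {l. l < n \<and> \<delta> l \<noteq> 0}")
    case True
    have "finite {t. D t \<delta> k = 0}"
      unfolding D_eq by (rule finite_zeros_det_hankel_affine[OF gen[OF \<delta> True]])
    then show ?thesis by (rule rev_finite_subset) auto
  next
    case False
    have "D t \<delta> k \<noteq> 0" if "t \<noteq> 0" for t
      unfolding D_def
    proof (rule det_hankel_moment_neq_0)
      have "{l. l < Suc n \<and> (c(n := t)) l * \<delta> l \<noteq> 0} = {l. l < Suc n \<and> \<delta> l \<noteq> 0}"
        using c that by auto
      then show "card {l. l < Suc n \<and> (c(n := t)) l * \<delta> l \<noteq> 0} = k"
        using False k by (auto simp: card_Suc of_bool_def split: if_splits)
    qed
    then have "{t. t \<noteq> 0 \<and> D t \<delta> k = 0} = {}" by auto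
    then show ?thesis by (simp only: finite.emptyI)
  qed
  \<comment> \<open>These are the values forbidden for the new weight: finitely many for each of
    finitely many patterns and sizes.\<close>
  define B where "B = (\<Union>\<delta> \<in> r ` {\<delta>. \<forall>l. \<delta> l \<in> {-1, 0, 1}}.
    \<Union>k \<in> {k. k \<le> card {l. l < Suc n \<and> \<delta> l \<noteq> 0}}. {t. t \<noteq> 0 \<and> D t \<delta> k = 0})"
  have card_r: "card {l. l < Suc n \<and> r \<delta> l \<noteq> 0} = card {l. l < Suc n \<and> \<delta> l \<noteq> 0}" for \<delta>
    by (rule arg_cong[of _ _ card]) (auto simp: r_def)
  have "r ` {\<delta>. \<forall>l. \<delta> l \<in> {-1, 0, 1}} \<subseteq> E"
    unfolding r_def E_def by (intro image_subsetI) (simp only: PiE_restrict restrict_PiE_iff, blast)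
  moreover have "finite E" unfolding E_def by (intro finite_PiE) auto
  ultimately have "finite (r ` {\<delta>. \<forall>l. \<delta> l \<in> {-1, 0, 1}})"
    by (rule finite_subset)
  then have "finite B"
    unfolding B_def using fin by (intro finite_UN_I) (auto simp: D_r card_r)
  then have "finite (insert 0 B)" by simp
  then obtain t where t: "t \<noteq> 0" "t \<notin> B"
    using ex_new_if_finite[OF infinite_UNIV_char_0] by blast
  have "D t \<delta> k \<noteq> 0" if "\<forall>l. \<delta> l \<in> {-1, 0, 1}" "k \<le> card {l. l < Suc n \<and> \<delta> l \<noteq> 0}" for \<delta> k
  proof
    assume "D t \<delta> k = 0"
    with that t(1) have "t \<in> B" unfolding B_def by (auto simp: D_r card_r)
    with t(2) show False ..
  qed
  then show ?case
    unfolding D_def using c t(1) by (intro exI[of _ "c(n := t)"]) auto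
qed

section \<open>The sign-rank bound\<close>

text \<open>On a finite set, \<open>e\<close> can lie below all positive values of \<open>f\<close>
  and \<open>M\<close> above all ratios \<open>f i / g i\<close>. The squared determinants of sizes
  \<open>k\<close> and \<open>k + 1\<close> will serve as \<open>f\<close> and
  \<open>g\<close>.\<close>

lemma exists_separating_constants:
  fixes f g :: "'a \<Rightarrow> real"
  assumes "finite I" "\<And>i. f i \<ge> 0" "\<And>i. g i \<ge> 0"
  shows "\<exists>e M. e > 0 \<and> (\<forall>i\<in>I. f i > 0 \<longrightarrow> f i > e) \<and> (\<forall>i\<in>I. g i > 0 \<longrightarrow> f i < M * g i)"
  using assms(1)
proof (induction I rule: finite_induct)
  case empty
  show ?case by (auto intro: exI[of _ 1])
next
  case (insert i I)
  then obtain e M where eM: "e > 0" "\<forall>i\<in>I. f i > 0 \<longrightarrow> f i > e" "\<forall>i\<in>I. g i > 0 \<longrightarrow> f i < M * g i"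
    by blast
  define e' where "e' = (if f i > 0 then min e (f i / 2) else e)"
  \<comment> \<open>The \<open>+ 1\<close> makes the inequality strict. If \<open>g i = 0\<close>,
    the quotient is 0 and nothing is claimed at \<open>i\<close>.\<close>
  define M' where "M' = max M ((f i + 1) / g i)"
  have "M * g j \<le> M' * g j" for j
    using assms(3) by (intro mult_right_mono) (auto simp: M'_def)
  moreover have "f i < M' * g i" if "g i > 0"
  proof -
    have "f i + 1 = (f i + 1) / g i * g i" using that by simp
    also have "\<dots> \<le> M' * g i" using that by (intro mult_right_mono) (auto simp: M'_def)
    finally show ?thesis by simp
  qed
  ultimately have "\<forall>j\<in>insert i I. g j > 0 \<longrightarrow> f j < M' * g j"
    using eM(3) by (auto intro: less_le_trans)
  moreover have "e' > 0" "\<forall>j\<in>insert i I. f j > 0 \<longrightarrow> f j > e'"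
    using eM(1,2) by (auto simp: e'_def min_less_iff_disj)
  ultimately show ?case by blast
qed

lemma hamming_dist_cube_point:
  "hamming_dist (cube_point n i) (cube_point n j) = card {l. l < n \<and> bit i l \<noteq> bit j l}"
  unfolding hamming_dist_def cube_point_def
  by (rule arg_cong[of _ _ card]) auto

lemma signrank_HD_le: "signrank (HD k n) \<le> 2 ^ (4 * k + 3)"
proof -
  obtain c :: "nat \<Rightarrow> real" where c: "\<And>l. c l \<noteq> 0"
    and gen: "\<And>\<delta> k. (\<forall>l. \<delta> l \<in> {-1, 0, 1}) \<Longrightarrow> k \<le> card {l. l < n \<and> \<delta> l \<noteq> 0} \<Longrightarrow>
      Determinant.det (hankel k (moment n (\<lambda>l. c l * \<delta> l))) \<noteq> 0"
    using exists_generic_weights[of n] by blast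
  define dist where "dist i j = card {l. l < n \<and> bit i l \<noteq> bit j l}" for i j :: nat
  define \<delta> :: "nat \<Rightarrow> nat \<Rightarrow> nat \<Rightarrow> real" where
    "\<delta> i j l = of_bool (bit i l) - of_bool (bit j l)" for i j l
  define D where "D k j i = Determinant.det (hankel k (moment n (\<lambda>l. c l * \<delta> i j l)))" for k i j
  have supp: "{l. l < n \<and> \<delta> i j l \<noteq> 0} = {l. l < n \<and> bit i l \<noteq> bit j l}" for i j
    by (auto simp: \<delta>_def of_bool_def split: if_splits)
  have D_iff: "D k j i = 0 \<longleftrightarrow> dist i j < k" for k i j
  proof
    assume "dist i j < k"
    then show "D k j i = 0"
      unfolding D_def by (intro det_hankel_moment_eq_0) (simp add: c supp dist_def)
  next
    assume "D k j i = 0"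
    moreover have "\<forall>l. \<delta> i j l \<in> {-1, 0, 1}" by (auto simp: \<delta>_def)
    ultimately show "dist i j < k"
      using gen[of "\<delta> i j" k] unfolding D_def supp dist_def by (meson not_le)
  qed
  obtain e M where e: "e > 0"
    and sep: "\<And>i j. i < 2 ^ n \<Longrightarrow> j < 2 ^ n \<Longrightarrow> (D k j i)\<^sup>2 > 0 \<Longrightarrow> (D k j i)\<^sup>2 > e"
      "\<And>i j. i < 2 ^ n \<Longrightarrow> j < 2 ^ n \<Longrightarrow> (D (Suc k) j i)\<^sup>2 > 0 \<Longrightarrow>
        (D k j i)\<^sup>2 < M * (D (Suc k) j i)\<^sup>2"
    using exists_separating_constants[of "{..<2 ^ n} \<times> {..<2 ^ n}"
        "\<lambda>(i, j). (D k j i)\<^sup>2" "\<lambda>(i, j). (D (Suc k) j i)\<^sup>2"] by fastforce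
  \<comment> \<open>Below distance \<open>k\<close> both determinants vanish and \<open>- e\<close>
    remains; at distance \<open>k\<close> only the first square survives, and it exceeds
    \<open>e\<close>; beyond \<open>k\<close> the term with \<open>M\<close> wins. The sum is
    written to fit the closure rules of \<open>hforms\<close>.\<close>
  define F where "F j i = (D k j i)\<^sup>2 + (- M) * (D (Suc k) j i)\<^sup>2 + (- e) * 1" for i j
  define A where "A = mat (2 ^ n) (2 ^ n) (\<lambda>(i, j). F j i)"
  have "sgn (F j i) = 2 * of_bool (dist i j = k) - 1" if ij: "i < 2 ^ n" "j < 2 ^ n" for i j
  proof -
    consider "dist i j < k" | "dist i j = k" | "dist i j > k" by linarith
    then show ?thesis
    proof cases
      case 1
      then have "D k j i = 0" "D (Suc k) j i = 0" by (simp_all add: D_iff)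
      with 1 e show ?thesis by (simp add: F_def)
    next
      case 2
      then have "D k j i \<noteq> 0" "D (Suc k) j i = 0" by (simp_all add: D_iff)
      with 2 sep(1)[OF ij] show ?thesis by (simp add: F_def)
    next
      case 3
      then have "D (Suc k) j i \<noteq> 0" by (simp add: D_iff)
      with 3 sep(2)[OF ij] e show ?thesis by (simp add: F_def)
    qed
  qed
  then have "sign_represents A (HD k n)"
    unfolding sign_represents_def pm_mat_def HD_def A_def
    by (auto intro!: eq_matI simp: hamming_dist_cube_point dist_def)
  then have "signrank (HD k n) \<le> vec_space.rank (2 ^ n) A"
    using signrank_le[of A "HD k n"] by (simp add: HD_def)
  also have "vec_space.rank (2 ^ n) A \<le> 2 ^ ((2 * k + 1) + (2 * k + 2))"
  proof (rule rank_le_hforms)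
    \<comment> \<open>Index 0 is the constant function. The moments of orders 0 to
      \<open>2 * k\<close>, those in a Hankel matrix of size \<open>k + 1\<close>, get the indices 1
      to \<open>2 * k + 1\<close>.\<close>
    define p :: "nat \<Rightarrow> nat \<Rightarrow> real" where
      "p m i = (if m = 0 then 1 else moment n (\<lambda>l. c l * of_bool (bit i l)) (m - 1))" for m i
    let ?H = "hforms p (2 * k + 1)"
    have p0: "p 0 i = 1" for i by (simp add: p_def)
    \<comment> \<open>Moments are linear in the weights; for fixed \<open>j\<close> its share is a
      constant, made homogeneous by \<open>p 0\<close>.\<close>
    have moment: "(\<lambda>i. moment n (\<lambda>l. c l * \<delta> i j l) m) \<in> ?H 1" if "m \<le> 2 * k" for m j
    proof -
      have "(\<lambda>i. p (Suc m) i + (- p (Suc m) j) * p 0 i) \<in> ?H 1"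
        using that by (intro hforms_add hforms_cmult hforms_gen) auto
      moreover have "moment n (\<lambda>l. c l * \<delta> i j l) m = p (Suc m) i + (- p (Suc m) j) * p 0 i" for i
        by (simp add: p_def moment_def \<delta>_def algebra_simps sum_subtractf)
      ultimately show ?thesis by simp
    qed
    have D: "D k' j \<in> ?H k'" if "k' \<le> Suc k" for k' j
    proof -
      have "(\<lambda>i. Determinant.det (hankel k' (moment n (\<lambda>l. c l * \<delta> i j l)))) \<in> ?H k'"
      proof (rule hforms_det)
        fix a b assume "a < k'" "b < k'"
        with that moment[of "a + b" j]
        show "(\<lambda>i. hankel k' (moment n (\<lambda>l. c l * \<delta> i j l)) $$ (a, b)) \<in> ?H 1"
          by (simp add: hankel_def)
      qed simp
      moreover have "D k' j = (\<lambda>i. Determinant.det (hankel k' (moment n (\<lambda>l. c l * \<delta> i j l))))"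
        by (simp add: D_def fun_eq_iff)
      ultimately show ?thesis by simp
    qed
    \<comment> \<open>The square has degree \<open>2 * k'\<close>; padding brings both sizes to the
      common degree \<open>2 * k + 2\<close>.\<close>
    have sq: "(\<lambda>i. (D k' j i)\<^sup>2) \<in> ?H (2 * k + 2)" if "k' \<le> Suc k" for k' j
    proof -
      have "(\<lambda>i. D k' j i * D k' j i) \<in> ?H (k' + k')"
        using that by (intro hforms_mult[of "D k' j" _ _ _ "D k' j"] D)
      then show ?thesis
        unfolding power2_eq_square by (rule hforms_mono) (use that in \<open>simp_all add: p0\<close>)
    qed
    have one: "(\<lambda>i. 1) \<in> ?H (2 * k + 2)"
      by (rule hforms_mono[OF hforms_one]) (simp_all add: p0)
    have "F j \<in> ?H (2 * k + 2)" for j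
      unfolding F_def by (intro hforms_add hforms_cmult sq one) auto
    then show "\<exists>f \<in> ?H (2 * k + 2). \<forall>r<2 ^ n. A $$ (r, j) = f r" if "j < 2 ^ n" for j
      using that by (intro bexI[of _ "F j"]) (auto simp: A_def)
  qed (simp add: A_def)
  also have "(2 * k + 1) + (2 * k + 2) = 4 * k + 3" by simp
  finally show ?thesis .
qed

(* The exponent is C * k for every k >= 1.  At k = 0 the matrix is the identity, whose sign-rank
   is 3 for n >= 2, so 2 ^ (C * 0) = 1 is not a bound; there "max 1 k" asks for a constant bound. *)
theorem theorem1p1:
  shows "\<exists>C::real. C > 0 \<and> (\<forall>n k :: nat. real (signrank (HD k n)) \<le> 2 powr (C * real (max 1 k)))"
proof (intro exI[of _ 7] conjI allI)
  fix n k :: nat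
  have "real (signrank (HD k n)) \<le> 2 ^ (4 * k + 3)"
    using signrank_HD_le[of k n] by (metis of_nat_le_iff of_nat_numeral of_nat_power)
  \<comment> \<open>For \<open>k \<ge> 1\<close> the summand 3 is at most \<open>3 * k\<close>,
    which gives the constant 7.\<close>
  also have "(2::real) ^ (4 * k + 3) \<le> 2 ^ (7 * max 1 k)"
    by (intro power_increasing) auto
  also have "\<dots> = 2 powr (7 * real (max 1 k))"
    by (simp flip: powr_realpow)
  finally show "real (signrank (HD k n)) \<le> 2 powr (7 * real (max 1 k))" .
qed simp

end
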